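(* Let $k\ge 2$ be an integer. If $G$ is a graph of order $n$ with minimum degree $\delta=\delta(G)$ satisfying \[ \delta \geq \sqrt{\frac{2123}{180}(k-1)n}, \] then $G$ has a $k$-proper partition into at most $\frac{2123\,n}{180\,\delta}$ parts.
   Context: All graphs are finite and simple. The order of a graph is its number of vertices, and $\delta(G)$ is the minimum degree of $G$. A graph $G$ is $k$-connected if the removal of any collection of fewer than $k$ vertices from $G$ results in a connected graph with at least two vertices (so a $k$-connected graph with $k\ge 1$ has at least $k+1$ vertices). For an integer $k\ge 1$, a partition $\mathcal{P}$ of the vertex set $V(G)$ is $k$-proper if for every part $P\in\mathcal{P}$ the induced subgraph $G[P]$ is $k$-connected. *)

theory Defs
  imports
    Complex_Main
    "HOL-Library.Disjoint_Sets"
    "Graph_Theory.Digraph_Component"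
begin

text \<open>
  A finite simple graph is an instance of the locale \<^locale>\<open>graph\<close>, i.e. a finite symmetric
  digraph without loops and parallel arcs. An undirected edge thus corresponds to a pair of
  opposite arcs, so the degree of a vertex is its out-degree.
\<close>

lemma (in graph) out_degree_eq_card_neighbours:
  "out_degree G v = card {w. v \<rightarrow>\<^bsub>G\<^esub> w}"
proof -
  have "{w. v \<rightarrow>\<^bsub>G\<^esub> w} = head G ` out_arcs G v"
    by (auto simp: arcs_ends_conv)
  moreover have "inj_on (head G) (out_arcs G v)"
    by (auto simp: inj_on_def arc_to_ends_def intro!: no_multi_arcs)
  ultimately show ?thesis
    by (simp add: out_degree_def card_image)
qed

text \<open>For the graph without vertices this is the unspecified \<^term>\<open>Min {} :: nat\<close>.\<close>

definition min_degree :: "('a, 'b) pre_digraph \<Rightarrow> nat" where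
  "min_degree G = Min (out_degree G ` verts G)"

text \<open>
  The name \<open>connected\<close> is qualified to distinguish it from topological connectedness.
\<close>

definition k_connected :: "nat \<Rightarrow> ('a, 'b) pre_digraph \<Rightarrow> bool" where
  "k_connected k G \<longleftrightarrow>
     (\<forall>S \<subseteq> verts G. card S < k \<longrightarrow>
        Digraph_Component.connected (G \<restriction> (verts G - S)) \<and>
        card (verts (G \<restriction> (verts G - S))) \<ge> 2)"

definition k_proper_partition :: "nat \<Rightarrow> ('a, 'b) pre_digraph \<Rightarrow> 'a set set \<Rightarrow> bool" where
  "k_proper_partition k G \<P> \<longleftrightarrow>
     partition_on (verts G) \<P> \<and> (\<forall>P \<in> \<P>. k_connected k (G \<restriction> P))"

end

theory Submission
  imports Defs
begin

text \<open>
  Write \<open>K = k - 1\<close>. The engine is an edge-counting argument in the style of Mader. Let \<open>D \<ge> 2K\<close>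
  and take an inclusion-minimal vertex set \<open>W\<close> that has at least \<open>D\<close> elements and spans more than
  \<open>D(|W| - K)\<close> edges. Deleting a vertex of degree at most \<open>D\<close> would preserve the bound, so all degrees
  in \<open>W\<close> exceed \<open>D\<close>. If at most \<open>K\<close> vertices separated \<open>W\<close>, then each of the two sides (with the separator
  added) would still have more than \<open>D\<close> vertices, and the edge bound would be inherited by one of
  them, because the two sides overlap in at most \<open>K\<close> vertices. Hence \<open>W\<close> is \<open>k\<close>-connected, and it has
  more than \<open>D\<close> vertices (\<open>dense_contains_k_connected\<close>). In particular, minimum degree \<open>2D\<close> forces a
  \<open>k\<close>-connected subgraph on more than \<open>D\<close> vertices.

  The partition is then a maximal packing. Take disjoint \<open>k\<close>-connected sets, each with more than
  \<open>\<delta>/4\<close> vertices, that cover as many vertices as possible; there are at most \<open>4n/\<delta>\<close> of them. An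
  uncovered vertex with \<open>k\<close> neighbours in one of the sets could be added to that set
  (\<open>cut_k_connected_insert\<close>), so every uncovered vertex sends at most \<open>K \<cdot> 4n/\<delta> \<le> \<delta>/2\<close> edges to the
  covered part as soon as \<open>\<delta>\<^sup>2 \<ge> 8Kn\<close>. If there were uncovered vertices, they would span a graph
  of minimum degree at least \<open>\<delta>/2 \<ge> 4K\<close>, in which the engine (with \<open>D = \<delta>/4\<close>) finds one more set
  to pack. So everything is covered (\<open>k_connected_partition_exists\<close>). The constant 8 in the
  hypothesis and the constant 4 in the conclusion both lie below 2123/180, which leaves ample room.
\<close>

section \<open>Connectivity of vertex sets through cuts\<close>

text \<open>
  The combinatorial argument only moves vertex sets around inside one ambient graph. It is therefore
  carried out for subsets of the domain of an adjacency relation, and connectedness is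
  phrased through cuts, since the counting argument needs a cut whenever connectedness fails.
\<close>

definition cut_connected :: "('a \<Rightarrow> 'a \<Rightarrow> bool) \<Rightarrow> 'a set \<Rightarrow> bool" where
  "cut_connected E X \<longleftrightarrow> X \<noteq> {} \<and>
     (\<forall>A. A \<subset> X \<and> A \<noteq> {} \<longrightarrow> (\<exists>a\<in>A. \<exists>b\<in>X - A. E a b))"

definition cut_k_connected :: "('a \<Rightarrow> 'a \<Rightarrow> bool) \<Rightarrow> nat \<Rightarrow> 'a set \<Rightarrow> bool" where
  "cut_k_connected E k X \<longleftrightarrow>
     (\<forall>S \<subseteq> X. card S < k \<longrightarrow> cut_connected E (X - S) \<and> card (X - S) \<ge> 2)"

definition degree_in :: "('a \<Rightarrow> 'a \<Rightarrow> bool) \<Rightarrow> 'a set \<Rightarrow> 'a \<Rightarrow> nat" where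
  "degree_in E X v = card {u \<in> X. E v u}"

lemma degree_in_mono: "finite Y \<Longrightarrow> X \<subseteq> Y \<Longrightarrow> degree_in E X v \<le> degree_in E Y v"
  unfolding degree_in_def by (intro card_mono) auto

lemma degree_in_Un_le: "degree_in E (X \<union> Y) v \<le> degree_in E X v + degree_in E Y v"
proof -
  have "{u \<in> X \<union> Y. E v u} = {u \<in> X. E v u} \<union> {u \<in> Y. E v u}" by auto
  then show ?thesis unfolding degree_in_def by (simp add: card_Un_le)
qed

lemma degree_in_less_card:
  assumes "finite X" "v \<in> X" "\<not> E v v"
  shows "degree_in E X v < card X"
  unfolding degree_in_def using assms by (intro psubset_card_mono) auto

lemma cut_connected_insert:
  assumes "symp E" "cut_connected E X" "x \<in> X" "E v x"
  shows "cut_connected E (insert v X)"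
proof (cases "v \<in> X")
  case True
  then show ?thesis using assms by (simp add: insert_absorb)
next
  case False
  have "\<exists>a\<in>A. \<exists>b\<in>insert v X - A. E a b" if A: "A \<subset> insert v X" "A \<noteq> {}" for A
  proof (cases "A \<inter> X = {} \<or> X \<subseteq> A")
    case True
    then show ?thesis
    proof
      assume "A \<inter> X = {}"
      with A have "A = {v}" by auto
      with assms(3,4) False show ?thesis by auto
    next
      assume "X \<subseteq> A"
      with A have "A = X" by auto
      moreover have "E x v" using assms(1,4) by (auto dest: sympD)
      ultimately show ?thesis using assms(3) False by auto
    qed
  next
    case False
    then have "A \<inter> X \<subset> X" "A \<inter> X \<noteq> {}" by auto
    with assms(2) obtain a b where "a \<in> A \<inter> X" "b \<in> X - A \<inter> X" "E a b"
      unfolding cut_connected_def by meson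
    then show ?thesis by auto
  qed
  then show ?thesis unfolding cut_connected_def by auto
qed

text \<open>
  Fewer than \<open>k\<close> deleted vertices cannot contain all \<open>k\<close> neighbours of the new vertex, which
  therefore stays attached to the connected remainder of the old set.
\<close>

lemma cut_k_connected_insert:
  assumes "symp E" "finite X" "cut_k_connected E k X" "v \<notin> X" "degree_in E X v \<ge> k"
  shows "cut_k_connected E k (insert v X)"
  unfolding cut_k_connected_def
proof (intro allI impI)
  fix S assume S: "S \<subseteq> insert v X" "card S < k"
  have finS: "finite S" using S(1) assms(2) by (meson finite.insertI finite_subset)
  show "cut_connected E (insert v X - S) \<and> card (insert v X - S) \<ge> 2"
  proof (cases "v \<in> S")
    case True
    have "card (S - {v}) < k" using S(2) card_Diff1_le[of S v] by linarith
    moreover have "S - {v} \<subseteq> X" using S(1) by auto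
    moreover have "X - (S - {v}) = insert v X - S" using True assms(4) by auto
    ultimately show ?thesis using assms(3) unfolding cut_k_connected_def by metis
  next
    case False
    have SX: "S \<subseteq> X" using S(1) False by auto
    have "\<not> {u \<in> X. E v u} \<subseteq> S"
    proof
      assume "{u \<in> X. E v u} \<subseteq> S"
      then have "degree_in E X v \<le> card S"
        unfolding degree_in_def using finS by (rule card_mono[rotated])
      with assms(5) S(2) show False by simp
    qed
    then obtain x where x: "x \<in> X - S" "E v x" by auto
    have old: "cut_connected E (X - S)" "card (X - S) \<ge> 2"
      using assms(3) SX S(2) unfolding cut_k_connected_def by auto
    have eq: "insert v X - S = insert v (X - S)" using False by auto
    have "card (X - S) \<le> card (insert v (X - S))"
      using assms(2) by (intro card_mono) auto
    then show ?thesis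
      using cut_connected_insert[OF assms(1) old(1) x] old(2) eq by simp
  qed
qed

section \<open>Dense graphs contain large highly connected subgraphs\<close>

definition degree_sum :: "('a \<Rightarrow> 'a \<Rightarrow> bool) \<Rightarrow> 'a set \<Rightarrow> nat" where
  "degree_sum E X = (\<Sum>v\<in>X. degree_in E X v)"

lemma degree_sum_remove:
  assumes "symp E" "finite X" "v \<in> X" "\<not> E v v"
  shows "degree_sum E X = degree_sum E (X - {v}) + 2 * degree_in E X v"
proof -
  have deg: "degree_in E X u = degree_in E (X - {v}) u + (if E v u then 1 else 0)"
    if "u \<in> X - {v}" for u
  proof (cases "E v u")
    case True
    then have "E u v" using assms(1) by (auto dest: sympD)
    then have "{w \<in> X. E u w} = insert v {w \<in> X - {v}. E u w}" using assms(3) by auto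
    then show ?thesis using True assms(2) unfolding degree_in_def by simp
  next
    case False
    then have "\<not> E u v" using assms(1) by (auto dest: sympD)
    then have "{w \<in> X. E u w} = {w \<in> X - {v}. E u w}" by auto
    then show ?thesis using False unfolding degree_in_def by simp
  qed
  have "(\<Sum>u\<in>X - {v}. degree_in E X u)
      = degree_sum E (X - {v}) + (\<Sum>u\<in>X - {v}. if E v u then 1 else 0)"
    unfolding degree_sum_def sum.distrib[symmetric] by (intro sum.cong) (auto simp: deg)
  also have "(\<Sum>u\<in>X - {v}. if E v u then 1 else 0) = card {u \<in> X - {v}. E v u}"
    using assms(2) by (subst sum.inter_filter[symmetric]) auto
  also have "{u \<in> X - {v}. E v u} = {u \<in> X. E v u}" using assms(4) by auto
  finally show ?thesis
    using assms(2,3) by (simp add: degree_sum_def sum.remove[of X v] degree_in_def)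
qed

text \<open>
  An edge of \<open>A \<union> B \<union> S\<close> lies in one of the two sides, as no edge joins \<open>A\<close> to \<open>B\<close>; the edges
  inside \<open>S\<close> are counted on both sides.
\<close>

lemma degree_sum_separation_le:
  assumes "symp E" "finite A" "finite B" "finite S"
    and "A \<inter> B = {}" "A \<inter> S = {}" "B \<inter> S = {}"
    and "\<And>a b. a \<in> A \<Longrightarrow> b \<in> B \<Longrightarrow> \<not> E a b"
  shows "degree_sum E (A \<union> B \<union> S) \<le> degree_sum E (A \<union> S) + degree_sum E (B \<union> S)"
proof -
  let ?d = "degree_in E (A \<union> B \<union> S)"
  have A: "?d a = degree_in E (A \<union> S) a" if "a \<in> A" for a
    unfolding degree_in_def using assms(8) that by (intro arg_cong[where f = card]) auto
  have B: "?d b = degree_in E (B \<union> S) b" if "b \<in> B" for b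
    unfolding degree_in_def using assms(1,8) that
    by (intro arg_cong[where f = card]) (auto dest: sympD)
  have S: "?d s \<le> degree_in E (A \<union> S) s + degree_in E (B \<union> S) s" for s
    using degree_in_Un_le[of E "A \<union> S" "B \<union> S" s] by (simp add: Un_ac)
  have "degree_sum E (A \<union> B \<union> S) = sum ?d A + sum ?d B + sum ?d S"
    unfolding degree_sum_def using assms(2-7)
    by (subst sum.union_disjoint; (subst sum.union_disjoint)?) auto
  also have "\<dots> \<le> (\<Sum>a\<in>A. degree_in E (A \<union> S) a) + (\<Sum>b\<in>B. degree_in E (B \<union> S) b)
      + (\<Sum>s\<in>S. degree_in E (A \<union> S) s + degree_in E (B \<union> S) s)"
    using A B S by (intro add_mono sum_mono) auto
  also have "\<dots> = degree_sum E (A \<union> S) + degree_sum E (B \<union> S)"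
    unfolding degree_sum_def using assms(2-7) by (simp add: sum.union_disjoint sum.distrib)
  finally show ?thesis .
qed

text \<open>
  In terms of edges the hypothesis reads \<open>e(X) > D(|X| - K)\<close> with \<open>K = k - 1\<close>. The offset \<open>K\<close> is
  chosen so that the bound adds up over a separation of order at most \<open>K\<close> into sides \<open>X\<^sub>1\<close> and \<open>X\<^sub>2\<close>:
  \<open>(|X\<^sub>1| - K) + (|X\<^sub>2| - K) \<le> |X| - K\<close>. The induction never leaves the range \<open>|X| \<ge> D\<close>, because
  for \<open>D \<le> |X| \<le> D + 1\<close> the inequality \<open>D \<ge> 2K\<close> gives \<open>D(|X| - K) \<ge> D|X|/2\<close>, which is
  at least the number of edges of a complete graph on \<open>X\<close>.
\<close>

lemma dense_contains_k_connected:
  fixes E :: "'a \<Rightarrow> 'a \<Rightarrow> bool" and D :: real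
  assumes "symp E" "irreflp E" "k \<ge> 1" "D \<ge> 2 * (real k - 1)"
    and "finite X" "real (card X) \<ge> D"
    and "real (degree_sum E X) > 2 * D * (real (card X) - (real k - 1))"
  shows "\<exists>W \<subseteq> X. cut_k_connected E k W \<and> real (card W) > D"
  using assms(5-7)
proof (induction "card X" arbitrary: X rule: less_induct)
  case less
  define K where "K = real k - 1"
  have K: "0 \<le> K" "2 * K \<le> D" using assms(3,4) by (auto simp: K_def)
  have irr: "\<not> E v v" for v using assms(2) by (auto dest: irreflpD)
  have fin: "finite X" by fact
  have dense: "real (degree_sum E X) > 2 * D * (real (card X) - K)"
    using less.prems(3) by (simp add: K_def)
  have large: "real (card X) > D + 1"
  proof (rule ccontr)
    assume "\<not> real (card X) > D + 1"
    then have small: "real (card X) - 1 \<le> D" by simp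
    have "real (degree_in E X v) \<le> D" if "v \<in> X" for v
      using degree_in_less_card[of X v E] fin that irr small by fastforce
    then have "real (degree_sum E X) \<le> real (card X) * D"
      unfolding degree_sum_def of_nat_sum by (rule sum_bounded_above)
    also have "\<dots> \<le> D * (2 * (real (card X) - K))"
      using less.prems(2) K by (subst mult.commute, intro mult_left_mono) auto
    finally show False using dense by (simp add: algebra_simps)
  qed
  show ?case
  proof (cases "\<exists>v\<in>X. real (degree_in E X v) \<le> D")
    case True
    then obtain v where v: "v \<in> X" "real (degree_in E X v) \<le> D" by auto
    have card: "card X = Suc (card (X - {v}))" using fin v(1) by (rule card.remove)
    have "real (degree_sum E X) \<le> real (degree_sum E (X - {v})) + 2 * D"
      using degree_sum_remove[OF assms(1) fin v(1) irr] v(2) by simp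
    then have "real (degree_sum E (X - {v})) > 2 * D * (real (card (X - {v})) - K)"
      using dense card by (simp add: algebra_simps)
    then have "\<exists>W \<subseteq> X - {v}. cut_k_connected E k W \<and> real (card W) > D"
      using large card fin by (intro less.hyps) (auto simp: K_def)
    then show ?thesis by auto
  next
    case False
    show ?thesis
    proof (cases "cut_k_connected E k X")
      case True
      then show ?thesis using large by auto
    next
      case nconn: False
      then obtain S where S: "S \<subseteq> X" "card S < k"
        and bad: "\<not> (cut_connected E (X - S) \<and> card (X - S) \<ge> 2)"
        unfolding cut_k_connected_def by blast
      have finS: "finite S" using S(1) fin finite_subset by blast
      have SK: "real (card S) \<le> K" using S(2) by (simp add: K_def)
      have cardS: "card (X - S) + card S = card X"
        using S(1) fin finS by (simp add: card_Diff_subset card_mono)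
      then have "real (card (X - S)) > 1" using large SK K by linarith
      then have "card (X - S) \<ge> 2" by simp
      moreover from this have "X - S \<noteq> {}" by (metis card.empty not_numeral_le_zero)
      ultimately obtain A where A: "A \<subset> X - S" "A \<noteq> {}"
        and noedge: "\<forall>a\<in>A. \<forall>b\<in>X - S - A. \<not> E a b"
        using bad unfolding cut_connected_def by blast
      define B where "B = X - S - A"
      have split: "X = A \<union> B \<union> S" "A \<inter> B = {}" "A \<inter> S = {}" "B \<inter> S = {}" "B \<noteq> {}"
        using A S(1) by (auto simp: B_def)
      have finAB: "finite A" "finite B" using fin split(1) by auto
      have noAB: "\<not> E a b" "\<not> E b a" if "a \<in> A" "b \<in> B" for a b
        using noedge that assms(1) by (auto simp: B_def dest: sympD)
      \<comment> \<open>A vertex of either side keeps all its neighbours, more than \<open>D\<close> of them, in that side.\<close>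
      have side: "real (card (Y \<union> S)) > D"
        if Y: "Y \<noteq> {}" "finite Y" "Y \<subseteq> X" "\<And>y u. y \<in> Y \<Longrightarrow> u \<in> X \<Longrightarrow> E y u \<Longrightarrow> u \<in> Y \<union> S" for Y
      proof -
        obtain y where y: "y \<in> Y" using Y(1) by auto
        have "degree_in E X y \<le> card (Y \<union> S)"
          unfolding degree_in_def using Y(2,4) y finS by (intro card_mono) auto
        then show ?thesis using False y Y(3) by (smt (verit) of_nat_le_iff subsetD)
      qed
      have bigA: "real (card (A \<union> S)) > D" and bigB: "real (card (B \<union> S)) > D"
        using side[of A] side[of B] A(2) split finAB noAB by blast+
      have cA: "card (A \<union> S) = card A + card S" and cB: "card (B \<union> S) = card B + card S"
        using finAB finS split by (auto simp: card_Un_disjoint)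
      have cX: "card X = card A + card B + card S"
        unfolding split(1) using finAB finS split(2-4)
        by (simp add: card_Un_disjoint Int_Un_distrib2)
      have pos: "card A > 0" "card B > 0" using finAB A(2) split(5) by (auto simp: card_gt_0_iff)
      have "degree_sum E X \<le> degree_sum E (A \<union> S) + degree_sum E (B \<union> S)"
        unfolding split(1) using degree_sum_separation_le[OF assms(1) finAB finS split(2-4)] noAB
        by blast
      moreover have "2 * D * (real (card (A \<union> S)) - K) + 2 * D * (real (card (B \<union> S)) - K)
          \<le> 2 * D * (real (card X) - K)"
        unfolding distrib_left[symmetric] using SK K cA cB cX by (intro mult_left_mono) auto
      ultimately have "real (degree_sum E (A \<union> S)) > 2 * D * (real (card (A \<union> S)) - K)
          \<or> real (degree_sum E (B \<union> S)) > 2 * D * (real (card (B \<union> S)) - K)"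
        using dense by linarith
      then obtain Y where "Y \<in> {A \<union> S, B \<union> S}"
        and Y: "real (degree_sum E Y) > 2 * D * (real (card Y) - K)" by blast
      moreover from this(1) have "card Y < card X" "finite Y" "real (card Y) \<ge> D" "Y \<subseteq> X"
        using pos cA cB cX bigA bigB finAB finS split(1) by auto
      ultimately have "\<exists>W \<subseteq> Y. cut_k_connected E k W \<and> real (card W) > D"
        using less.hyps[of Y] by (simp add: K_def)
      then show ?thesis using \<open>Y \<subseteq> X\<close> by blast
    qed
  qed
qed

lemma min_degree_contains_k_connected:
  fixes E :: "'a \<Rightarrow> 'a \<Rightarrow> bool" and D :: real
  assumes "symp E" "irreflp E" "k \<ge> 2" "D \<ge> 2 * (real k - 1)"
    and "finite X" "X \<noteq> {}" "\<And>v. v \<in> X \<Longrightarrow> real (degree_in E X v) \<ge> 2 * D"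
  shows "\<exists>W \<subseteq> X. cut_k_connected E k W \<and> real (card W) > D"
proof (rule dense_contains_k_connected[OF assms(1,2) _ assms(4,5)])
  have D: "D > 0" using assms(3,4) by simp
  obtain v where v: "v \<in> X" using assms(6) by auto
  have "degree_in E X v < card X"
    using degree_in_less_card[OF assms(5) v] assms(2) by (auto dest: irreflpD)
  then show "real (card X) \<ge> D" using assms(7)[OF v] D by linarith
  have "real (card X) * (2 * D) \<le> real (degree_sum E X)"
    unfolding degree_sum_def of_nat_sum using assms(7) by (rule sum_bounded_below)
  moreover have "2 * D * (real k - 1) > 0" using D assms(3) by simp
  ultimately show "real (degree_sum E X) > 2 * D * (real (card X) - (real k - 1))"
    by (simp add: algebra_simps)
qed (use assms(3) in simp)

section \<open>Partitioning by a maximal packing\<close>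

lemma degree_in_Union_le:
  assumes "finite F" "\<And>P. P \<in> F \<Longrightarrow> degree_in E P v \<le> m"
  shows "degree_in E (\<Union>F) v \<le> card F * m"
  using assms
proof (induction F rule: finite_induct)
  case (insert P F)
  then show ?case using degree_in_Un_le[of E P "\<Union>F" v] by fastforce
qed (simp add: degree_in_def)

lemma partition_on_card_le:
  fixes m :: real
  assumes "finite U" "partition_on U F" "\<And>P. P \<in> F \<Longrightarrow> real (card P) \<ge> m"
  shows "real (card F) * m \<le> real (card U)"
proof -
  have "real (card F) * m \<le> (\<Sum>P\<in>F. real (card P))"
    using assms(3) by (rule sum_bounded_below)
  also have "\<dots> = real (card (\<Union>F))"
    using assms(1,2) unfolding partition_on_def
    by (subst card_Union_disjoint) (auto simp: disjoint_def pairwise_def disjnt_def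
        dest: finite_subset[OF Union_upper])
  finally show ?thesis using assms(2) by (simp add: partition_on_def)
qed

text \<open>
  The number of parts stays below \<open>4n/\<delta>\<close> throughout because every part has more than \<open>\<delta>/4\<close>
  vertices; growing a part never violates this, so lower bounds on sizes are all that has to be
  tracked.
\<close>

theorem k_connected_partition_exists:
  fixes E :: "'a \<Rightarrow> 'a \<Rightarrow> bool" and \<delta> :: real
  assumes "symp E" "irreflp E" "k \<ge> 2" "finite V"
    and "\<delta> \<ge> 0" "\<And>v. v \<in> V \<Longrightarrow> real (degree_in E V v) \<ge> \<delta>"
    and "\<delta>\<^sup>2 \<ge> 8 * (real k - 1) * real (card V)"
  shows "\<exists>F. partition_on V F \<and> (\<forall>P\<in>F. cut_k_connected E k P) \<and>
    real (card F) * \<delta> \<le> 4 * real (card V)"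
proof -
  define packed where "packed U \<longleftrightarrow> U \<subseteq> V \<and> (\<exists>F. partition_on U F \<and>
      (\<forall>P\<in>F. cut_k_connected E k P \<and> real (card P) > \<delta> / 4))" for U
  have "packed {}" by (auto simp: packed_def intro!: exI[of _ "{}"] simp: partition_on_def)
  moreover have "finite {U. packed U}"
    using assms(4) by (rule finite_subset[rotated, OF finite_Pow_iff[THEN iffD2]])
      (auto simp: packed_def)
  ultimately obtain U where "packed U" and max: "\<And>U'. packed U' \<Longrightarrow> U \<subseteq> U' \<Longrightarrow> U' = U"
    using finite_has_maximal[of "{U. packed U}"] by (metis empty_iff mem_Collect_eq)
  then obtain F where UV: "U \<subseteq> V" and part: "partition_on U F"
    and parts: "\<And>P. P \<in> F \<Longrightarrow> cut_k_connected E k P" "\<And>P. P \<in> F \<Longrightarrow> real (card P) > \<delta> / 4"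
    unfolding packed_def by auto
  have finU: "finite U" using UV assms(4) finite_subset by blast
  have finF: "finite F" using part finU by (rule finite_elements[rotated])
  have UF: "U = \<Union>F" using part by (simp add: partition_on_def)
  have "real (card F) * (\<delta> / 4) \<le> real (card U)"
    using partition_on_card_le[OF finU part, of "\<delta> / 4"] parts(2) by (simp add: less_imp_le)
  moreover have "card U \<le> card V" using UV assms(4) by (simp add: card_mono)
  ultimately have count: "real (card F) * \<delta> \<le> 4 * real (card V)" by simp
  have "U = V"
  proof (rule ccontr)
    assume "U \<noteq> V"
    define R where "R = V - U"
    have R: "R \<noteq> {}" "finite R" "V = U \<union> R" "U \<inter> R = {}"
      using \<open>U \<noteq> V\<close> UV assms(4) by (auto simp: R_def)
    define K where "K = real k - 1"
    have K: "K \<ge> 1" using assms(3) by (simp add: K_def)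
    have sq: "8 * K * real (card V) \<le> \<delta>\<^sup>2" using assms(7) by (simp add: K_def)
    have Vpos: "card V > 0" using R assms(4) by (auto simp: card_gt_0_iff)
    have dpos: "\<delta> > 0"
    proof (rule ccontr)
      assume "\<not> \<delta> > 0"
      then have "\<delta> = 0" using assms(5) by simp
      then have "8 * K * real (card V) \<le> 0" using sq by simp
      moreover have "8 * K * real (card V) > 0" using K Vpos by simp
      ultimately show False by simp
    qed
    obtain r where r: "r \<in> R" using R(1) by auto
    have "degree_in E V r < card V"
      using degree_in_less_card[OF assms(4), of r E] r R(3) assms(2) by (auto dest: irreflpD)
    then have "\<delta> \<le> real (card V)" using assms(6)[of r] r R(3) by force
    then have "8 * K * \<delta> \<le> 8 * K * real (card V)" using K by (intro mult_left_mono) auto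
    then have "8 * K * \<delta> \<le> \<delta> * \<delta>" using sq by (simp add: power2_eq_square)
    then have dK: "8 * K \<le> \<delta>" using dpos by simp

    have few: "degree_in E P v \<le> k - 1" if "v \<in> R" "P \<in> F" for v P
    proof (rule ccontr)
      assume "\<not> degree_in E P v \<le> k - 1"
      then have deg: "degree_in E P v \<ge> k" by simp
      have PU: "P \<subseteq> U" using that(2) UF by auto
      have finP: "finite P" using PU finU by (rule finite_subset)
      have vP: "v \<notin> P" "v \<notin> U" using PU that(1) R(4) by auto
      have conn: "cut_k_connected E k (insert v P)"
        using cut_k_connected_insert[OF assms(1) finP parts(1)[OF that(2)] vP(1) deg] .
      let ?F = "insert (insert v P) (F - {P})"
      have others: "disjnt P (\<Union>(F - {P}))"
        using partition_onD2[OF part] that(2) by (auto simp: disjoint_def disjnt_def)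
      moreover have "partition_on U (insert P (F - {P}))"
        using part that(2) by (simp add: insert_absorb)
      ultimately have "partition_on (U - P) (F - {P})"
        using partition_on_insert by blast
      moreover have "insert v U - insert v P = U - P" using vP(2) by auto
      moreover have "disjnt (insert v P) (\<Union>(F - {P}))"
        using others vP(2) UF by (auto simp: disjnt_def)
      ultimately have "partition_on (insert v U) ?F"
        using PU by (subst partition_on_insert) auto
      moreover have "real (card (insert v P)) > \<delta> / 4"
        using parts(2)[OF that(2)] finP vP(1) by simp
      ultimately have "packed (insert v U)"
        unfolding packed_def using conn parts UV that(1) R(3) by (intro conjI exI[of _ ?F]) auto
      then show False using max vP(2) by blast
    qed
    have "real (degree_in E R v) \<ge> 2 * (\<delta> / 4)" if "v \<in> R" for v
    proof -
      have "degree_in E U v \<le> card F * (k - 1)"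
        unfolding UF using finF few[OF that] by (rule degree_in_Union_le)
      then have "real (degree_in E U v) \<le> real (card F * (k - 1))" by (simp only: of_nat_le_iff)
      also have "\<dots> = real (card F) * K" using assms(3) by (simp add: K_def of_nat_diff)
      finally have "real (degree_in E U v) \<le> real (card F) * K" .
      moreover have "real (card F) * K \<le> \<delta> / 2"
      proof -
        have "real (card F) * K * \<delta> \<le> 4 * K * real (card V)"
          using mult_left_mono[OF count, of K] K by (simp add: mult_ac)
        also have "\<dots> \<le> \<delta> / 2 * \<delta>" using sq by (simp add: power2_eq_square)
        finally show ?thesis using dpos by simp
      qed
      moreover have "degree_in E V v \<le> degree_in E U v + degree_in E R v"
        unfolding R(3) by (rule degree_in_Un_le)
      moreover have "\<delta> \<le> real (degree_in E V v)" using assms(6) that R(3) by blast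
      ultimately show ?thesis by linarith
    qed
    moreover have "\<delta> / 4 \<ge> 2 * (real k - 1)" using dK by (simp add: K_def)
    ultimately obtain W where W: "W \<subseteq> R" "cut_k_connected E k W" "real (card W) > \<delta> / 4"
      using min_degree_contains_k_connected[OF assms(1-3) _ R(2,1)] by blast
    have "W \<noteq> {}" using W(3) dpos by auto
    have "U \<union> W - W = U" "disjnt W (\<Union>F)" using W(1) R(4) UF by (auto simp: disjnt_def)
    with \<open>W \<noteq> {}\<close> part have "partition_on (U \<union> W) (insert W F)"
      by (simp only: partition_on_insert) simp
    then have "packed (U \<union> W)"
      unfolding packed_def using W parts UV R(3) by (intro conjI exI[of _ "insert W F"]) auto
    then show False using max \<open>W \<noteq> {}\<close> W(1) R(4) by blast
  qed
  then show ?thesis using part parts(1) count by blast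
qed

section \<open>Transfer to graphs\<close>

text \<open>
  The set of vertices reachable from a given vertex has no outgoing edge, so it cannot be
  a proper subset of a set in which every cut is crossed.
\<close>

lemma (in wf_digraph) connected_if_cut_connected:
  assumes "cut_connected (\<lambda>u v. u \<rightarrow>\<^bsub>G\<^esub> v) X"
  shows "Digraph_Component.connected (G \<restriction> X)"
proof -
  interpret X: wf_digraph "G \<restriction> X" by auto
  interpret M: pair_wf_digraph "mk_symmetric (G \<restriction> X)" by (rule X.wellformed_mk_symmetric)
  have "u \<rightarrow>\<^sup>*\<^bsub>mk_symmetric (G \<restriction> X)\<^esub> v" if uv: "u \<in> X" "v \<in> X" for u v
  proof (rule X.reachable_mk_symmetricI)
    let ?A = "{w \<in> X. u \<rightarrow>\<^sup>*\<^bsub>G \<restriction> X\<^esub> w}"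
    have "u \<in> ?A" using uv(1) by simp
    have "?A = X"
    proof (rule ccontr)
      assume "?A \<noteq> X"
      then have "?A \<subset> X" "?A \<noteq> {}" using \<open>u \<in> ?A\<close> by auto
      then obtain a b where ab: "a \<in> ?A" "b \<in> X - ?A" "a \<rightarrow>\<^bsub>G\<^esub> b"
        using assms unfolding cut_connected_def by meson
      then have "a \<rightarrow>\<^bsub>G \<restriction> X\<^esub> b" by (auto simp: arcs_ends_conv)
      then have "u \<rightarrow>\<^sup>*\<^bsub>G \<restriction> X\<^esub> b" using ab(1) X.reachable_adj_trans by blast
      with ab(2) show False by simp
    qed
    then show "u \<rightarrow>\<^sup>*\<^bsub>G \<restriction> X\<^esub> v" using uv(2) by blast
  qed
  moreover have "X \<noteq> {}" using assms by (simp add: cut_connected_def)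
  ultimately show ?thesis
    unfolding Digraph_Component.connected_def by (intro strongly_connectedI) auto
qed

lemma (in wf_digraph) k_connected_if_cut_k_connected:
  assumes "cut_k_connected (\<lambda>u v. u \<rightarrow>\<^bsub>G\<^esub> v) k X"
  shows "k_connected k (G \<restriction> X)"
proof -
  have "(G \<restriction> X) \<restriction> (X - S) = G \<restriction> (X - S)" for S
    by (auto simp: induce_subgraph_def)
  then show ?thesis
    using assms connected_if_cut_connected unfolding k_connected_def cut_k_connected_def by auto
qed

theorem theorem4:
  fixes G :: "('a, 'b) pre_digraph" and k :: nat
  assumes "k \<ge> 2"
    and "graph G"
    and "real (min_degree G) \<ge> sqrt (2123 / 180 * (real k - 1) * real (card (verts G)))"
  shows "\<exists>\<P>. k_proper_partition k G \<P> \<and>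
    real (card \<P>) \<le> 2123 * real (card (verts G)) / (180 * real (min_degree G))"
proof -
  interpret graph G by fact
  let ?n = "real (card (verts G))" and ?\<delta> = "real (min_degree G)"
  let ?E = "\<lambda>u v. u \<rightarrow>\<^bsub>G\<^esub> v"
  have "symp ?E" using graph_symmetric by (auto intro: sympI)
  have "irreflp ?E" using adj_not_same by (auto intro: irreflpI)
  have deg: "real (degree_in ?E (verts G) v) \<ge> ?\<delta>" if "v \<in> verts G" for v
  proof -
    have "{w \<in> verts G. v \<rightarrow>\<^bsub>G\<^esub> w} = {w. v \<rightarrow>\<^bsub>G\<^esub> w}" using adj_in_verts by auto
    then have "degree_in ?E (verts G) v = out_degree G v"
      by (simp add: degree_in_def out_degree_eq_card_neighbours)
    then show ?thesis using that by (simp add: min_degree_def)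
  qed
  have sq: "2123 / 180 * (real k - 1) * ?n \<le> ?\<delta>\<^sup>2"
    using assms(3) by (rule sqrt_le_D)
  moreover have "8 * ((real k - 1) * ?n) \<le> 2123 / 180 * ((real k - 1) * ?n)"
    using assms(1) by (intro mult_right_mono) auto
  ultimately have "?\<delta>\<^sup>2 \<ge> 8 * (real k - 1) * ?n" by linarith
  then obtain F where F: "partition_on (verts G) F" "\<forall>P\<in>F. cut_k_connected ?E k P"
    and count: "real (card F) * ?\<delta> \<le> 4 * ?n"
    using k_connected_partition_exists[OF \<open>symp ?E\<close> \<open>irreflp ?E\<close> assms(1) _ _ deg] by auto
  have "real (card F) \<le> 2123 * ?n / (180 * ?\<delta>)"
  proof (cases "verts G = {}")
    case True
    then show ?thesis using F(1) by (simp add: partition_on_empty)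
  next
    case False
    then have "0 < 2123 / 180 * (real k - 1) * ?n" using assms(1) by (simp add: card_gt_0_iff)
    then have "?\<delta> > 0" using sq by (smt (verit) of_nat_0_le_iff zero_power2)
    moreover have "4 * ?n \<le> 2123 / 180 * ?n" by simp
    ultimately show ?thesis using count by (simp add: field_simps)
  qed
  then show ?thesis
    using F k_connected_if_cut_k_connected unfolding k_proper_partition_def by blast
qed

end
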